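(* Let $X$ be a finite set and let $f:2^X\to\mathbb{R}$ be a non-decreasing submodular function such that $f(\emptyset)=0$. Then there is $k\ge1$, a map $\phi:X\to\mathbb{R}^k$ and a compact convex set $K\subseteq\mathbb{R}^k$ with nonempty interior such that, for all $A\subseteq X$, $$f(A)=R(\phi(A)\cup\{0\},K)=\inf\{\lambda\ge0:\phi(A)\cup\{0\}\subseteq\lambda K+z\text{ for some }z\in\mathbb{R}^k\}.$$
   Context: A function $f:2^X\to\mathbb{R}$ is non-decreasing if $A\subseteq B$ implies $f(A)\le f(B)$, and submodular if $f(A\cup B)+f(A\cap B)\le f(A)+f(B)$ for all $A,B\subseteq X$. For a compact convex set $K\subseteq\mathbb{R}^k$ with nonempty interior and a bounded set $S\subseteq\mathbb{R}^k$, the generalized circumradius is $R(S,K)=\inf\{\lambda\ge0:S\subseteq\lambda K+z\text{ for some }z\in\mathbb{R}^k\}$. $\phi(A)=\{\phi(a):a\in A\}$, and $\phi$ need not be injective. *)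

theory Defs
  imports "HOL-Analysis.Analysis"
begin

text \<open>The dimension \<open>k\<close> is existentially quantified, so \<open>R^k\<close> is rendered as the topological space
  \<^term>\<open>Euclidean_space k\<close>: its points are the sequences \<open>x :: nat \<Rightarrow> real\<close> with \<open>x i = 0\<close> for all
  \<open>i \<ge> k\<close>. Since \<open>nat \<Rightarrow> real\<close> is not an instance of \<^class>\<open>real_vector\<close>, the linear operations are
  written out coordinatewise.\<close>

definition submodular_on :: "'a set \<Rightarrow> ('a set \<Rightarrow> real) \<Rightarrow> bool" where
  "submodular_on X f \<longleftrightarrow>
     (\<forall>A B. A \<subseteq> X \<longrightarrow> B \<subseteq> X \<longrightarrow> f (A \<union> B) + f (A \<inter> B) \<le> f A + f B)"

definition convex_seq :: "(nat \<Rightarrow> real) set \<Rightarrow> bool" where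
  "convex_seq K \<longleftrightarrow>
     (\<forall>x\<in>K. \<forall>y\<in>K. \<forall>u\<ge>0. \<forall>v\<ge>0. u + v = 1 \<longrightarrow> (\<lambda>i. u * x i + v * y i) \<in> K)"

definition homothet :: "real \<Rightarrow> (nat \<Rightarrow> real) set \<Rightarrow> (nat \<Rightarrow> real) \<Rightarrow> (nat \<Rightarrow> real) set" where
  "homothet l K z = (\<lambda>x i. l * x i + z i) ` K"

text \<open>The infimum is taken in the reals. It is the genuine one for bounded \<open>S\<close> and \<open>K\<close> with nonempty
  interior in \<^term>\<open>Euclidean_space k\<close>: the set is then nonempty, and it is bounded below by 0.\<close>

definition circumradius :: "nat \<Rightarrow> (nat \<Rightarrow> real) set \<Rightarrow> (nat \<Rightarrow> real) set \<Rightarrow> real" where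
  "circumradius k S K =
     Inf {l. 0 \<le> l \<and> (\<exists>z \<in> topspace (Euclidean_space k). S \<subseteq> homothet l K z)}"

end

theory Submission
  imports Defs
begin

text \<open>The radius \<open>R(S, K)\<close> can be computed exactly when \<open>K\<close> is a product of simplices
  \<open>{x. x \<le> 0, \<Sum> x \<ge> -1}\<close>. A translate \<open>l K + z\<close> of one simplex contains a set \<open>S\<close> of nonnegative
  points that includes the origin iff its corner \<open>z\<close> dominates every point of \<open>S\<close> coordinatewise
  and \<open>\<Sum> z \<le> l\<close>; so the best corner is the coordinatewise maximum of \<open>S\<close>, and the radius is the
  sum of its coordinates. For a product, every factor has to be covered with the same \<open>l\<close>, so the
  radius is the maximum over the factors (\<open>subset_homothet_simplex_product_iff\<close>).

  One simplex therefore realises any additive function \<open>A \<mapsto> \<Sum>a\<in>A. w a\<close> with \<open>w \<ge> 0\<close>: send \<open>a\<close> to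
  \<open>w a\<close> times its own unit vector. A product realises any maximum of finitely many such functions.
  A non-decreasing submodular function vanishing at the empty set is such a maximum: marginal values
  along an enumeration of \<open>A\<close> give weights whose additive function stays below \<open>f\<close> and meets it at
  \<open>A\<close> (\<open>submodular_supporting_weight\<close>). The product then has one simplex for each subset of \<open>X\<close>.\<close>

section \<open>Submodular functions as maxima of additive functions\<close>

text \<open>Adding the marginal value \<open>f (insert a A) - f A\<close> as the weight of the new element keeps the
  weights below \<open>f\<close>, because by submodularity \<open>a\<close> contributes at least as much to each subset of \<open>A\<close>
  as it does to \<open>A\<close>; monotonicity makes it nonnegative. The weights vanish outside \<open>A\<close> so that a set
  \<open>C\<close> can be replaced by \<open>C \<inter> insert a A\<close> in the comparison.\<close>
lemma submodular_supporting_weight: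
  fixes f :: "'a set \<Rightarrow> real"
  assumes X: "finite X" and mono: "mono_on (Pow X) f" and sub: "submodular_on X f"
    and f0: "f {} = 0" and A: "A \<subseteq> X"
  shows "\<exists>w. (\<forall>a. 0 \<le> w a) \<and> (\<forall>a. a \<notin> A \<longrightarrow> w a = 0)
           \<and> (\<forall>C\<subseteq>X. sum w C \<le> f C) \<and> sum w A = f A"
  using finite_subset[OF A X] A
proof (induction A rule: finite_induct)
  case empty
  have "0 \<le> f C" if "C \<subseteq> X" for C
    using mono_onD[OF mono, of "{}" C] that f0 by auto
  then show ?case by (intro exI[of _ "\<lambda>_. 0"]) (auto simp: f0)
next
  case (insert a A)
  then obtain w where w0: "\<And>a. 0 \<le> w a" and wA: "\<And>a. a \<notin> A \<Longrightarrow> w a = 0"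
    and wC: "\<And>C. C \<subseteq> X \<Longrightarrow> sum w C \<le> f C" and w_eq: "sum w A = f A"
    by auto
  define w' where "w' = w(a := f (insert a A) - f A)"
  have "f A \<le> f (insert a A)"
    using mono_onD[OF mono, of A "insert a A"] insert.prems by auto
  then have "0 \<le> w' b" for b
    using w0 by (simp add: w'_def)
  moreover have "w' b = 0" if "b \<notin> insert a A" for b
    using that wA by (simp add: w'_def)
  moreover have "sum w' (insert a A) = f (insert a A)"
  proof -
    have "sum w' A = sum w A"
      using insert.hyps by (intro sum.cong) (auto simp: w'_def)
    then show ?thesis using insert.hyps w_eq by (simp add: w'_def)
  qed
  moreover have "sum w' C \<le> f C" if C: "C \<subseteq> X" for C
  proof (cases "a \<in> C")
    case False
    then have "sum w' C = sum w C"
      by (intro sum.cong) (auto simp: w'_def)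
    then show ?thesis using wC[OF C] by simp
  next
    case True
    define D where "D = C \<inter> insert a A"
    have D: "D \<subseteq> X" and fin: "finite C"
      using C insert.prems finite_subset[OF C X] by (auto simp: D_def)
    have "f (A \<union> D) + f (A \<inter> D) \<le> f A + f D"
      using sub D insert.prems by (simp add: submodular_on_def)
    moreover have "A \<union> D = insert a A" "A \<inter> D = A \<inter> C"
      using True by (auto simp: D_def)
    moreover have "f D \<le> f C"
      using mono_onD[OF mono, of D C] C D by (auto simp: D_def)
    moreover have "sum w (A \<inter> C) \<le> f (A \<inter> C)"
      using C by (intro wC) auto
    moreover have "sum w' C = w' a + sum w' (C - {a})"
      using True fin by (simp add: sum.remove)
    moreover have "sum w' (C - {a}) = sum w (A \<inter> C)"
      using fin insert.hyps wA by (intro sum.mono_neutral_cong_right) (auto simp: w'_def)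
    ultimately show ?thesis by (simp add: w'_def)
  qed
  ultimately show ?case by blast
qed

section \<open>Products of simplices\<close>

text \<open>The first \<open>k\<close> coordinates are partitioned into the fibres of \<open>p\<close>; each nonempty fibre carries
  one simplex. A value \<open>b\<close> with empty fibre imposes the vacuous condition \<open>-1 \<le> 0\<close>.\<close>
definition simplex_product :: "nat \<Rightarrow> (nat \<Rightarrow> 'b) \<Rightarrow> (nat \<Rightarrow> real) set" where
  "simplex_product k p =
     {x \<in> topspace (Euclidean_space k).
        (\<forall>i<k. x i \<le> 0) \<and> (\<forall>b. -1 \<le> (\<Sum>i | i < k \<and> p i = b. x i))}"

lemma convex_seq_simplex_product: "convex_seq (simplex_product k p)"
  unfolding convex_seq_def
proof (intro ballI allI impI)
  fix x y :: "nat \<Rightarrow> real" and u v :: real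
  assume x: "x \<in> simplex_product k p" and y: "y \<in> simplex_product k p"
    and uv: "0 \<le> u" "0 \<le> v" "u + v = 1"
  have "u * x i + v * y i \<le> 0" if "i < k" for i
    using x y uv that by (auto simp: simplex_product_def intro!: add_nonpos_nonpos mult_nonneg_nonpos)
  moreover have "-1 \<le> (\<Sum>i | i < k \<and> p i = b. u * x i + v * y i)" for b
  proof -
    have "-1 = u * (-1) + v * (-1)" using uv by simp
    also have "\<dots> \<le> u * (\<Sum>i | i < k \<and> p i = b. x i) + v * (\<Sum>i | i < k \<and> p i = b. y i)"
      using x y uv by (intro add_mono mult_left_mono) (auto simp: simplex_product_def)
    finally show ?thesis by (simp add: sum.distrib sum_distrib_left)
  qed
  ultimately show "(\<lambda>i. u * x i + v * y i) \<in> simplex_product k p"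
    using x y by (auto simp: simplex_product_def topspace_Euclidean_space)
qed

lemma compactin_simplex_product: "compactin (Euclidean_space k) (simplex_product k p)"
proof -
  define B :: "(nat \<Rightarrow> real) set" where
    "B = PiE UNIV (\<lambda>i. if i < k then {-1..0} else {0})"
  define F where "F = {x :: nat \<Rightarrow> real. \<forall>b. -1 \<le> (\<Sum>i | i < k \<and> p i = b. x i)}"
  have "compactin (powertop_real UNIV) B"
    by (auto simp: B_def compactin_PiE)
  then have "compact B"
    by (simp add: euclidean_product_topology)
  moreover have "closed F"
    unfolding F_def
    by (intro closed_Collect_all closed_Collect_le continuous_intros) auto
  ultimately have "compact (B \<inter> F)" by blast
  moreover have "simplex_product k p = B \<inter> F"
  proof (intro equalityI subsetI)
    fix x assume x: "x \<in> simplex_product k p"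
    have "-1 \<le> x i" if i: "i < k" for i
    proof -
      have "(\<Sum>j | j < k \<and> p j = p i. x j) = x i + (\<Sum>j \<in> {j. j < k \<and> p j = p i} - {i}. x j)"
        using i by (simp add: sum.remove)
      moreover have "(\<Sum>j \<in> {j. j < k \<and> p j = p i} - {i}. x j) \<le> 0"
        using x by (intro sum_nonpos) (auto simp: simplex_product_def)
      moreover have "-1 \<le> (\<Sum>j | j < k \<and> p j = p i. x j)"
        using x by (auto simp: simplex_product_def)
      ultimately show ?thesis by linarith
    qed
    then show "x \<in> B \<inter> F"
      using x by (auto simp: simplex_product_def B_def F_def topspace_Euclidean_space)
  next
    fix x assume "x \<in> B \<inter> F"
    then show "x \<in> simplex_product k p"
      by (auto simp: simplex_product_def B_def F_def topspace_Euclidean_space PiE_iff split: if_splits)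
        (metis not_less)
  qed
  ultimately show ?thesis
    by (auto simp: Euclidean_space_def compactin_subtopology euclidean_product_topology
        simplex_product_def topspace_Euclidean_space)
qed

text \<open>If all the first \<open>k\<close> coordinates lie strictly between \<open>-1/k\<close> and \<open>0\<close>, then every fibre sum
  exceeds \<open>-1\<close>, whatever the partition.\<close>
lemma interior_simplex_product_nonempty:
  "Euclidean_space k interior_of simplex_product k p \<noteq> {}"
proof -
  define U where "U = {x :: nat \<Rightarrow> real. \<forall>i\<in>{..<k}. -1 / real k < x i \<and> x i < 0}"
  define V where "V = U \<inter> topspace (Euclidean_space k)"
  have "open U"
  proof -
    have "U = (\<Inter>i\<in>{..<k}. {x. -1 / real k < x i} \<inter> {x. x i < 0})"
      by (auto simp: U_def)
    moreover have "open \<dots>"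
      by (intro open_INT ballI open_Int open_Collect_less continuous_intros) auto
    ultimately show ?thesis by simp
  qed
  then have "openin (Euclidean_space k) V"
    by (auto simp: V_def Euclidean_space_def openin_subtopology euclidean_product_topology
        topspace_Euclidean_space)
  moreover have "V \<subseteq> simplex_product k p"
  proof
    fix x assume x: "x \<in> V"
    have "-1 \<le> (\<Sum>i | i < k \<and> p i = b. x i)" for b
    proof -
      have "-1 \<le> (\<Sum>i<k. -1 / real k)" by simp
      also have "\<dots> \<le> (\<Sum>i<k. x i)"
        using x by (intro sum_mono) (auto simp: V_def U_def intro: less_imp_le)
      also have "\<dots> = (\<Sum>i | i < k \<and> p i = b. x i) + (\<Sum>i \<in> {..<k} - {i. i < k \<and> p i = b}. x i)"
        by (subst sum.subset_diff[of "{i. i < k \<and> p i = b}"]) auto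
      also have "(\<Sum>i \<in> {..<k} - {i. i < k \<and> p i = b}. x i) \<le> 0"
        using x by (intro sum_nonpos) (auto simp: V_def U_def intro: less_imp_le)
      finally show ?thesis by simp
    qed
    then show "x \<in> simplex_product k p"
      using x by (auto simp: simplex_product_def V_def U_def intro: less_imp_le)
  qed
  moreover have "(\<lambda>i. if i < k then -1 / (2 * real k) else 0) \<in> V"
    by (auto simp: V_def U_def topspace_Euclidean_space field_simps)
  ultimately show ?thesis
    using interior_of_maximal by blast
qed

section \<open>Covering by homothets of a product of simplices\<close>

text \<open>The point \<open>u\<close> is the coordinatewise maximum of \<open>S\<close>. Any \<open>z\<close> that works dominates \<open>u\<close>, since
  \<open>K \<le> 0\<close>, and the fibre sums of \<open>z\<close> are at most \<open>l\<close>, since the origin is covered. Conversely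
  \<open>z = u\<close> works, because the points of \<open>S\<close> are nonnegative.\<close>
lemma subset_homothet_simplex_product_iff:
  fixes S :: "(nat \<Rightarrow> real) set"
  assumes l: "0 \<le> l" and S: "S \<subseteq> topspace (Euclidean_space k)" and zero: "(\<lambda>_. 0) \<in> S"
    and nonneg: "\<And>x i. x \<in> S \<Longrightarrow> 0 \<le> x i"
    and upper: "\<And>x i. x \<in> S \<Longrightarrow> x i \<le> u i" and attained: "\<And>i. \<exists>x\<in>S. x i = u i"
  shows "(\<exists>z \<in> topspace (Euclidean_space k). S \<subseteq> homothet l (simplex_product k p) z) \<longleftrightarrow>
           (\<forall>b. (\<Sum>i | i < k \<and> p i = b. u i) \<le> l)"
proof
  assume "\<exists>z \<in> topspace (Euclidean_space k). S \<subseteq> homothet l (simplex_product k p) z"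
  then obtain z where z: "S \<subseteq> homothet l (simplex_product k p) z" by blast
  have uz: "u i \<le> z i" if "i < k" for i
  proof -
    obtain x where x: "x \<in> S" "x i = u i" using attained by blast
    then obtain y where "y \<in> simplex_product k p" "x = (\<lambda>i. l * y i + z i)"
      using z by (auto simp: homothet_def)
    moreover from this have "l * y i \<le> 0"
      using l that by (intro mult_nonneg_nonpos) (auto simp: simplex_product_def)
    ultimately show ?thesis using x by simp
  qed
  obtain y where y: "y \<in> simplex_product k p" "(\<lambda>_. 0) = (\<lambda>i. l * y i + z i)"
    using z zero by (auto simp: homothet_def)
  then have zy: "z i = l * - y i" for i
    using fun_cong[OF y(2), of i] by simp
  show "\<forall>b. (\<Sum>i | i < k \<and> p i = b. u i) \<le> l"
  proof
    fix b
    have "(\<Sum>i | i < k \<and> p i = b. u i) \<le> (\<Sum>i | i < k \<and> p i = b. z i)"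
      using uz by (intro sum_mono) auto
    also have "\<dots> = l * - (\<Sum>i | i < k \<and> p i = b. y i)"
      by (simp add: zy sum_distrib_left sum_negf)
    also have "\<dots> \<le> l * 1"
      using y l by (intro mult_left_mono) (auto simp: simplex_product_def minus_le_iff)
    finally show "(\<Sum>i | i < k \<and> p i = b. u i) \<le> l" by simp
  qed
next
  assume sums: "\<forall>b. (\<Sum>i | i < k \<and> p i = b. u i) \<le> l"
  have u0: "0 \<le> u i" for i using upper[OF zero] by simp
  have u: "u \<in> topspace (Euclidean_space k)"
    unfolding topspace_Euclidean_space
  proof (intro CollectI allI impI)
    fix i assume "k \<le> i"
    moreover obtain x where "x \<in> S" "x i = u i" using attained by blast
    ultimately show "u i = 0" using S by (auto simp: topspace_Euclidean_space)
  qed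
  have "x \<in> homothet l (simplex_product k p) u" if x: "x \<in> S" for x
  proof -
    \<comment> \<open>For \<open>l = 0\<close> the division makes \<open>y\<close> zero, which is right because then \<open>x = u = 0\<close>.\<close>
    define y where "y i = (x i - u i) / l" for i
    have xE: "x \<in> topspace (Euclidean_space k)" using x S by blast
    have "x i = l * y i + u i" for i
    proof (cases "l = 0")
      case False
      then show ?thesis by (simp add: y_def)
    next
      case True
      have "u i = 0"
      proof (cases "i < k")
        case True
        have "u i \<le> (\<Sum>j | j < k \<and> p j = p i. u j)"
          using True u0 by (intro member_le_sum) auto
        also have "\<dots> \<le> 0" using sums \<open>l = 0\<close> by blast
        finally show ?thesis using u0[of i] by simp
      next
        case False
        then show ?thesis using u by (simp add: topspace_Euclidean_space)
      qed
      then show ?thesis using upper[OF x, of i] nonneg[OF x, of i] True by simp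
    qed
    then have "x = (\<lambda>i. l * y i + u i)" by blast
    moreover have "y \<in> simplex_product k p"
    proof -
      have "y i \<le> 0" for i
        using upper[OF x] l by (auto simp: y_def intro!: divide_nonpos_nonneg)
      moreover have "-1 \<le> (\<Sum>i | i < k \<and> p i = b. y i)" for b
      proof (cases "l = 0")
        case False
        have "- l \<le> - (\<Sum>i | i < k \<and> p i = b. u i)" using sums by simp
        also have "\<dots> \<le> (\<Sum>i | i < k \<and> p i = b. x i - u i)"
          using nonneg[OF x] by (simp add: sum_subtractf sum_nonneg)
        finally have "- l / l \<le> (\<Sum>i | i < k \<and> p i = b. x i - u i) / l"
          using l by (intro divide_right_mono)
        then show ?thesis using False by (simp add: y_def sum_divide_distrib)
      qed (simp add: y_def)
      moreover have "y \<in> topspace (Euclidean_space k)"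
        using u xE by (auto simp: y_def topspace_Euclidean_space)
      ultimately show ?thesis by (simp add: simplex_product_def)
    qed
    ultimately show ?thesis by (auto simp: homothet_def)
  qed
  then show "\<exists>z \<in> topspace (Euclidean_space k). S \<subseteq> homothet l (simplex_product k p) z"
    using u by blast
qed

section \<open>Realisation as a generalized circumradius\<close>

theorem proposition22:
  fixes X :: "'a set" and f :: "'a set \<Rightarrow> real"
  assumes "finite X"
    and "mono_on (Pow X) f"
    and "submodular_on X f"
    and "f {} = 0"
  shows "\<exists>k \<ge> 1. \<exists>\<phi> :: 'a \<Rightarrow> nat \<Rightarrow> real. \<exists>K :: (nat \<Rightarrow> real) set.
           \<phi> ` X \<subseteq> topspace (Euclidean_space k) \<and>
           compactin (Euclidean_space k) K \<and> convex_seq K \<and>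
           Euclidean_space k interior_of K \<noteq> {} \<and>
           (\<forall>A \<subseteq> X. f A = circumradius k (\<phi> ` A \<union> {\<lambda>_. 0}) K)"
proof -
  have "\<forall>B\<in>Pow X. \<exists>w. (\<forall>a. 0 \<le> w a) \<and> (\<forall>C\<subseteq>X. sum w C \<le> f C) \<and> sum w B = f B"
  proof
    fix B assume "B \<in> Pow X"
    then show "\<exists>w. (\<forall>a. 0 \<le> w a) \<and> (\<forall>C\<subseteq>X. sum w C \<le> f C) \<and> sum w B = f B"
      using submodular_supporting_weight[OF assms, of B] by auto
  qed
  from bchoice[OF this] obtain w where "\<forall>B\<in>Pow X.
      (\<forall>a. 0 \<le> w B a) \<and> (\<forall>C\<subseteq>X. sum (w B) C \<le> f C) \<and> sum (w B) B = f B" ..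
  then have w_nonneg: "\<And>B a. B \<subseteq> X \<Longrightarrow> 0 \<le> w B a"
    and w_le: "\<And>B C. B \<subseteq> X \<Longrightarrow> C \<subseteq> X \<Longrightarrow> sum (w B) C \<le> f C"
    and w_eq: "\<And>B. B \<subseteq> X \<Longrightarrow> sum (w B) B = f B"
    by auto
  \<comment> \<open>A coordinate is indexed by a pair: the subset of \<open>X\<close> whose simplex it belongs to, and the element
    of \<open>X\<close> that is mapped onto its axis.
    The coordinates labelled \<open>None\<close> are zero on all points; they make the dimension positive even
    for empty \<open>X\<close>.\<close>
  define I where "I = Pow X \<times> insert None (Some ` X)"
  define k where "k = card I"
  have finI: "finite I" using assms(1) by (simp add: I_def)
  have "I \<noteq> {}" by (auto simp: I_def)
  then have k: "1 \<le> k" using finI by (simp add: k_def Suc_le_eq card_gt_0_iff)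
  obtain idx where idx: "bij_betw idx {0..<k} I"
    using ex_bij_betw_nat_finite[OF finI] by (auto simp: k_def)
  have idx_mem: "fst (idx i) \<subseteq> X" if "i < k" for i
    using bij_betwE[OF idx] that by (simp add: I_def mem_Times_iff)
  define p where "p i = fst (idx i)" for i
  define \<phi> where "\<phi> a i = (if i < k \<and> snd (idx i) = Some a then w (p i) a else 0)" for a i
  let ?K = "simplex_product k p"
  have phi_E: "\<phi> a \<in> topspace (Euclidean_space k)" for a
    by (simp add: \<phi>_def topspace_Euclidean_space)
  have phi_nonneg: "0 \<le> \<phi> a i" for a i
    using w_nonneg idx_mem by (simp add: \<phi>_def p_def)
  have "f A = circumradius k (\<phi> ` A \<union> {\<lambda>_. 0}) ?K" if A: "A \<subseteq> X" for A
  proof -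
    let ?S = "\<phi> ` A \<union> {\<lambda>_. 0}"
    define u where "u i = (case snd (idx i) of None \<Rightarrow> 0 | Some a \<Rightarrow> if a \<in> A then \<phi> a i else 0)" for i
    have upper: "x i \<le> u i" if "x \<in> ?S" for x i
      using that w_nonneg idx_mem by (auto simp: u_def \<phi>_def p_def split: option.splits)
    have attained: "\<exists>x\<in>?S. x i = u i" for i
      by (auto simp: u_def split: option.splits)
    have sums: "(\<Sum>i | i < k \<and> p i = B. u i) = (if B \<subseteq> X then sum (w B) A else 0)" for B
    proof (cases "B \<subseteq> X")
      case False
      then have "{i. i < k \<and> p i = B} = {}" using idx_mem by (auto simp: p_def)
      then show ?thesis using False by (simp only: sum.empty if_False)
    next
      case True
      define g where "g q = (case snd q of None \<Rightarrow> 0 | Some a \<Rightarrow> if a \<in> A then w B a else 0)"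
        for q :: "'a set \<times> 'a option"
      have "bij_betw idx {i. i < k \<and> p i = B} ({B} \<times> insert None (Some ` X))"
      proof (rule bij_betw_subset[OF idx])
        show "idx ` {i. i < k \<and> p i = B} = {B} \<times> insert None (Some ` X)"
        proof (intro equalityI subsetI)
          fix q assume q: "q \<in> {B} \<times> insert None (Some ` X)"
          then have "q \<in> I" using True by (auto simp: I_def)
          then obtain i where "i < k" "q = idx i"
            using bij_betw_imp_surj_on[OF idx] by auto
          then show "q \<in> idx ` {i. i < k \<and> p i = B}" using q by (auto simp: p_def)
        next
          fix q assume "q \<in> idx ` {i. i < k \<and> p i = B}"
          then obtain i where i: "i < k" "p i = B" "q = idx i" by auto
          then have "q \<in> I" using bij_betwE[OF idx] by auto
          then show "q \<in> {B} \<times> insert None (Some ` X)" using i by (auto simp: I_def p_def)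
        qed
      qed auto
      then have "(\<Sum>i | i < k \<and> p i = B. g (idx i)) = sum g ({B} \<times> insert None (Some ` X))"
        by (rule sum.reindex_bij_betw)
      also have "\<dots> = (\<Sum>c\<in>insert None (Some ` X). g (B, c))"
        by (rule sum.reindex_bij_witness[of _ "Pair B" snd]) auto
      also have "\<dots> = (\<Sum>a\<in>X. if a \<in> A then w B a else 0)"
        using assms(1) by (simp add: g_def sum.reindex)
      also have "\<dots> = sum (w B) A"
        using A assms(1) by (simp add: sum.If_cases Int_absorb1)
      finally have "(\<Sum>i | i < k \<and> p i = B. g (idx i)) = sum (w B) A" .
      moreover have "(\<Sum>i | i < k \<and> p i = B. g (idx i)) = (\<Sum>i | i < k \<and> p i = B. u i)"
        by (intro sum.cong) (auto simp: g_def u_def \<phi>_def split: option.splits)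
      ultimately show ?thesis using True by simp
    qed
    have f_nonneg: "0 \<le> f A"
      using mono_onD[OF assms(2), of "{}" A] A assms(4) by auto
    have "(\<exists>z \<in> topspace (Euclidean_space k). ?S \<subseteq> homothet l ?K z) \<longleftrightarrow> f A \<le> l" if l: "0 \<le> l" for l
    proof -
      have "(\<exists>z \<in> topspace (Euclidean_space k). ?S \<subseteq> homothet l ?K z) \<longleftrightarrow>
          (\<forall>B. (\<Sum>i | i < k \<and> p i = B. u i) \<le> l)"
      proof (rule subset_homothet_simplex_product_iff[OF l])
        show "?S \<subseteq> topspace (Euclidean_space k)"
          using phi_E by (auto simp: topspace_Euclidean_space)
        show "0 \<le> x i" if "x \<in> ?S" for x i using that phi_nonneg by auto
        show "x i \<le> u i" if "x \<in> ?S" for x i using that by (rule upper)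
        show "\<exists>x\<in>?S. x i = u i" for i by (rule attained)
      qed auto
      also have "\<dots> \<longleftrightarrow> (\<forall>B\<subseteq>X. sum (w B) A \<le> l)"
        using l by (auto simp: sums)
      also have "\<dots> \<longleftrightarrow> f A \<le> l"
      proof
        assume "\<forall>B\<subseteq>X. sum (w B) A \<le> l"
        then show "f A \<le> l" using w_eq[OF A] A by auto
      next
        assume "f A \<le> l"
        then show "\<forall>B\<subseteq>X. sum (w B) A \<le> l" using w_le[OF _ A] by (blast intro: order_trans)
      qed
      finally show ?thesis .
    qed
    then have "{l. 0 \<le> l \<and> (\<exists>z \<in> topspace (Euclidean_space k). ?S \<subseteq> homothet l ?K z)} = {f A..}"
      using f_nonneg by auto
    then show ?thesis by (simp add: circumradius_def)
  qed
  then show ?thesis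
    using k phi_E compactin_simplex_product[of k p] convex_seq_simplex_product[of k p]
      interior_simplex_product_nonempty[of k p]
    by (intro exI[of _ k] conjI exI[of _ \<phi>] exI[of _ ?K]) auto
qed

end
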